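(* Let $G=(V,E)$ be a finite graph. Suppose that $A,B,C\subseteq E$ are chosen independently and uniformly at random, and let $\Delta$ be the event that $A,B,C$ have pairwise eulerian symmetric differences (i.e. $A\bigtriangleup B$, $B\bigtriangleup C$, $C\bigtriangleup A$ are all eulerian). Then the event that $|A|+|B|+|C|\equiv 0,1,2 \pmod 6$ (i.e. that $\left\lfloor\frac{|A|+|B|+|C|}{3}\right\rfloor$ is even) is correlated with $\Delta$ as follows: $$\frac{\mathrm{Bias}(|A|+|B|+|C|\equiv 0,1,2\ (\mathrm{mod}\ 6)\,\mid\,\Delta)}{\mathrm{Bias}(|A|+|B|+|C|\equiv 0,1,2\ (\mathrm{mod}\ 6))}=3^{-|E|}\,4^{r(G)}\,F(G;4).$$
   Context: Graphs are finite; loops and parallel edges are permitted. A subset $A\subseteq E$ is identified with the subgraph $(V,A)$ of $G$; it is called eulerian if all its vertex degrees are even (a loop contributes 2 to the degree). $\bigtriangleup$ is symmetric difference of sets. $r(G)=|V|-k(G)$, where $k(G)$ is the number of connected components of $G$. $F(G;q)$ is the number of nowhere-zero $\mathbb{Z}_q$-flows of $G$ (with respect to any fixed orientation). For an event $\Sigma$, $\mathrm{Bias}(\Sigma)=\mathbb{P}(\Sigma)-\mathbb{P}(\overline{\Sigma})$ and $\mathrm{Bias}(\Sigma\mid\Delta)=\mathbb{P}(\Sigma\mid\Delta)-\mathbb{P}(\overline{\Sigma}\mid\Delta)$, where $\overline{\Sigma}$ is the complement of $\Sigma$. *)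

theory Defs
  imports
    "HOL-Probability.Probability"
    "HOL-Number_Theory.Cong"
    "HOL-Library.Uprod"
begin

text \<open>
  Finite multigraphs: every edge has an unordered pair of end vertices, where \<open>Upair v v\<close>
  makes it a loop at \<open>v\<close>.
\<close>

record ('v, 'e) multigraph =
  vertices :: "'v set"
  edges :: "'e set"
  ends :: "'e \<Rightarrow> 'v uprod"

definition finite_multigraph :: "('v, 'e, 'x) multigraph_scheme \<Rightarrow> bool" where
  "finite_multigraph G \<longleftrightarrow>
     finite (vertices G) \<and> finite (edges G) \<and>
     (\<forall>e\<in>edges G. set_uprod (ends G e) \<subseteq> vertices G)"

text \<open>The second summand counts loops once more, so that a loop contributes 2 in total.\<close>

definition degree_in :: "('v, 'e, 'x) multigraph_scheme \<Rightarrow> 'e set \<Rightarrow> 'v \<Rightarrow> nat" where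
  "degree_in G A v =
     card {e \<in> A. v \<in> set_uprod (ends G e)} + card {e \<in> A. ends G e = Upair v v}"

definition eulerian :: "('v, 'e, 'x) multigraph_scheme \<Rightarrow> 'e set \<Rightarrow> bool" where
  "eulerian G A \<longleftrightarrow> (\<forall>v\<in>vertices G. even (degree_in G A v))"

definition adjacency :: "('v, 'e, 'x) multigraph_scheme \<Rightarrow> ('v \<times> 'v) set" where
  "adjacency G = {(u, v). \<exists>e\<in>edges G. ends G e = Upair u v}"

definition components :: "('v, 'e, 'x) multigraph_scheme \<Rightarrow> 'v set set" where
  "components G =
     vertices G // {(u, v). u \<in> vertices G \<and> v \<in> vertices G \<and> (u, v) \<in> (adjacency G)\<^sup>*}"

text \<open>The subtraction does not truncate, as every component of a finite multigraph is nonempty.\<close>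

definition graph_rank :: "('v, 'e, 'x) multigraph_scheme \<Rightarrow> nat" where
  "graph_rank G = card (vertices G) - card (components G)"

definition orientation ::
    "('v, 'e, 'x) multigraph_scheme \<Rightarrow> ('e \<Rightarrow> 'v) \<Rightarrow> ('e \<Rightarrow> 'v) \<Rightarrow> bool" where
  "orientation G tail head \<longleftrightarrow> (\<forall>e\<in>edges G. ends G e = Upair (tail e) (head e))"

text \<open>
  Elements of \<open>\<int>/q\<int>\<close> are represented by their residues in \<open>{0..<q}\<close>, with
  conservation at every vertex imposed modulo \<open>q\<close>. Flows are extensional functions on the
  edge set, so that each is counted once.
\<close>

definition nowhere_zero_flows ::
    "('v, 'e, 'x) multigraph_scheme \<Rightarrow> ('e \<Rightarrow> 'v) \<Rightarrow> ('e \<Rightarrow> 'v) \<Rightarrow> nat \<Rightarrow> ('e \<Rightarrow> nat) set" where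
  "nowhere_zero_flows G tail head q =
     {f \<in> edges G \<rightarrow>\<^sub>E {0..<q}.
        (\<forall>e\<in>edges G. f e \<noteq> 0) \<and>
        (\<forall>v\<in>vertices G.
           [(\<Sum>e | e \<in> edges G \<and> head e = v. f e) = (\<Sum>e | e \<in> edges G \<and> tail e = v. f e)] (mod q))}"

definition flow_number ::
    "('v, 'e, 'x) multigraph_scheme \<Rightarrow> ('e \<Rightarrow> 'v) \<Rightarrow> ('e \<Rightarrow> 'v) \<Rightarrow> nat \<Rightarrow> nat" where
  "flow_number G tail head q = card (nowhere_zero_flows G tail head q)"

definition bias :: "'a measure \<Rightarrow> ('a \<Rightarrow> bool) \<Rightarrow> real" where
  "bias M P = \<P>(x in M. P x) - \<P>(x in M. \<not> P x)"

definition cond_bias :: "'a measure \<Rightarrow> ('a \<Rightarrow> bool) \<Rightarrow> ('a \<Rightarrow> bool) \<Rightarrow> real" where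
  "cond_bias M P Q = \<P>(x in M. P x \<bar> Q x) - \<P>(x in M. \<not> P x \<bar> Q x)"

definition random_edge_sets ::
    "('v, 'e, 'x) multigraph_scheme \<Rightarrow> ('e set \<times> 'e set \<times> 'e set) pmf" where
  "random_edge_sets G =
     pair_pmf (pmf_of_set (Pow (edges G)))
       (pair_pmf (pmf_of_set (Pow (edges G))) (pmf_of_set (Pow (edges G))))"

definition pairwise_eulerian ::
    "('v, 'e, 'x) multigraph_scheme \<Rightarrow> 'e set \<times> 'e set \<times> 'e set \<Rightarrow> bool" where
  "pairwise_eulerian G = (\<lambda>(A, B, C).
     eulerian G (sym_diff A B) \<and> eulerian G (sym_diff B C) \<and> eulerian G (sym_diff C A))"

definition size_012_mod_6 :: "'e set \<times> 'e set \<times> 'e set \<Rightarrow> bool" where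
  "size_012_mod_6 = (\<lambda>(A, B, C). (card A + card B + card C) mod 6 \<in> {0, 1, 2})"

end

theory Submission
  imports Defs
begin

text \<open>
  The sign of the event is an antiperiodic function of \<open>|A| + |B| + |C|\<close> with period 3, so it is a
  linear combination of the functions \<open>z ^ (|A| + |B| + |C|)\<close> with \<open>z\<^sup>3 = -1\<close>. For such a \<open>z\<close>
  the sum of these powers over all triples is \<open>(1 + z) ^ (3|E|) = (3(z + z\<^sup>2)) ^ |E|\<close>. On \<open>\<Delta>\<close>,
  write \<open>X\<close> and \<open>Y\<close> for the differences of \<open>A\<close> and \<open>B\<close> with \<open>C\<close>: summing over \<open>C\<close> for fixed
  eulerian \<open>X\<close> and \<open>Y\<close>, each edge of \<open>X \<union> Y\<close> contributes a factor \<open>z + z\<^sup>2\<close> and every other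
  edge a factor \<open>1 + z\<^sup>3 = 0\<close>. Hence the two sums differ by a factor that does not depend on \<open>z\<close>
  and involves the number of pairs of eulerian sets with union \<open>E\<close>.

  These pairs correspond to nowhere-zero \<open>\<int>/4\<close>-flows: the odd part \<open>X\<close> of a flow is eulerian, and
  every eulerian \<open>X\<close> lifts to a \<open>\<int>/4\<close>-flow with support \<open>X\<close>, so the flows with odd part \<open>X\<close>
  are obtained from it by adding twice an eulerian set \<open>W\<close>, and such a flow is nowhere zero if and
  only if \<open>X \<union> W = E\<close>. The lifting and the count of the eulerian sets both rest on the
  existence of \<open>T\<close>-joins.
\<close>

section \<open>Symmetric differences\<close>

lemma odd_card_sym_diff:
  assumes "finite A" "finite B"
  shows "odd (card (sym_diff A B)) \<longleftrightarrow> odd (card A) \<noteq> odd (card B)"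
proof -
  have "card (sym_diff A B) = card (A - B) + card (B - A)"
    using assms by (intro card_Un_disjoint) auto
  moreover have "card A = card (A - B) + card (A \<inter> B)"
    using assms by (subst card_Un_disjoint [symmetric]) (auto intro: arg_cong [where f = card])
  moreover have "card B = card (B - A) + card (A \<inter> B)"
    using assms by (subst card_Un_disjoint [symmetric]) (auto intro: arg_cong [where f = card])
  ultimately show ?thesis
    by presburger
qed

lemma odd_card_filter_sym_diff:
  assumes "finite A" "finite B"
  shows "odd (card {x \<in> sym_diff A B. P x}) \<longleftrightarrow> odd (card {x \<in> A. P x}) \<noteq> odd (card {x \<in> B. P x})"
proof -
  have eq: "{x \<in> sym_diff A B. P x} = sym_diff {x \<in> A. P x} {x \<in> B. P x}"
    by auto
  show ?thesis
    unfolding eq using assms by (intro odd_card_sym_diff) auto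
qed

lemma sym_diff_cancel [simp]:
  "sym_diff A (sym_diff A B) = B" "sym_diff (sym_diff A B) B = A"
  by blast+

text \<open>Rank-nullity over the field with two elements: translation by one member of a fibre maps
  that fibre bijectively onto the kernel, so all nonempty fibres have the same size.\<close>

lemma card_kernel_times_card_image_sym_diff:
  fixes h :: "'a set \<Rightarrow> 'b set"
  assumes "finite E"
    and hom: "\<And>A B. A \<subseteq> E \<Longrightarrow> B \<subseteq> E \<Longrightarrow> h (sym_diff A B) = sym_diff (h A) (h B)"
  shows "card {A \<in> Pow E. h A = {}} * card (h ` Pow E) = 2 ^ card E"
proof -
  have fiber: "card {A \<in> Pow E. h A = T} = card {A \<in> Pow E. h A = {}}" if T: "T \<in> h ` Pow E" for T
  proof -
    obtain A0 where A0: "A0 \<subseteq> E" "h A0 = T"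
      using T by auto
    have "bij_betw (sym_diff A0) {A \<in> Pow E. h A = T} {A \<in> Pow E. h A = {}}"
    proof (rule bij_betw_byWitness [where f' = "sym_diff A0"])
      show "sym_diff A0 ` {A \<in> Pow E. h A = T} \<subseteq> {A \<in> Pow E. h A = {}}"
        using A0 by (auto simp: hom)
      show "sym_diff A0 ` {A \<in> Pow E. h A = {}} \<subseteq> {A \<in> Pow E. h A = T}"
        using A0 by (auto simp: hom)
    qed (simp_all only: sym_diff_cancel, simp_all)
    then show ?thesis
      by (rule bij_betw_same_card)
  qed
  have "2 ^ card E = card (Pow E)"
    using assms(1) by (simp add: card_Pow)
  also have "\<dots> = (\<Sum>T\<in>h ` Pow E. card {A \<in> Pow E. h A = T})"
    using sum.image_gen [of "Pow E" "\<lambda>_. 1::nat" h] assms(1) by simp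
  also have "\<dots> = card {A \<in> Pow E. h A = {}} * card (h ` Pow E)"
    using fiber by simp
  finally show ?thesis ..
qed

lemma sum_Pow_power_card:
  fixes z :: "'a :: comm_semiring_1"
  assumes "finite E"
  shows "(\<Sum>A\<in>Pow E. z ^ card A) = (1 + z) ^ card E"
  using prod_add [of E "\<lambda>_. z" "\<lambda>_. 1"] assms by (simp add: add.commute)

section \<open>Boundaries and eulerian sets\<close>

locale oriented_multigraph =
  fixes G :: "('v, 'e) multigraph" and tail head :: "'e \<Rightarrow> 'v"
  assumes finite_multigraph: "finite_multigraph G"
    and orientation: "orientation G tail head"
begin

abbreviation V where "V \<equiv> vertices G"
abbreviation E where "E \<equiv> edges G"

text \<open>The boundary map of chains modulo 2. Heads and tails are counted separately, so a loop
  counts twice and cancels; the same counts appear in the conservation law for flows.\<close>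

definition boundary :: "'e set \<Rightarrow> 'v set" where
  "boundary A = {v \<in> V. odd (card {e \<in> A. head e = v} + card {e \<in> A. tail e = v})}"

lemma finite_V [simp]: "finite V" and finite_E [simp]: "finite E"
  using finite_multigraph by (auto simp: finite_multigraph_def)

lemma finite_subset_E: "A \<subseteq> E \<Longrightarrow> finite A"
  using finite_E finite_subset by blast

lemma ends_eq: "e \<in> E \<Longrightarrow> ends G e = Upair (tail e) (head e)"
  using orientation by (simp add: orientation_def)

lemma tail_in_V [simp]: "e \<in> E \<Longrightarrow> tail e \<in> V" and head_in_V [simp]: "e \<in> E \<Longrightarrow> head e \<in> V"
  using finite_multigraph ends_eq by (auto simp: finite_multigraph_def)

text \<open>Inclusion-exclusion: the edges lying in both sets on the right are the loops at
  \<open>v\<close>, which \<open>degree_in\<close> counts a second time.\<close>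

lemma degree_in_eq:
  assumes "A \<subseteq> E"
  shows "degree_in G A v = card {e \<in> A. head e = v} + card {e \<in> A. tail e = v}"
proof -
  have "{e \<in> A. v \<in> set_uprod (ends G e)} = {e \<in> A. head e = v} \<union> {e \<in> A. tail e = v}"
    "{e \<in> A. ends G e = Upair v v} = {e \<in> A. head e = v} \<inter> {e \<in> A. tail e = v}"
    using assms ends_eq by auto
  then show ?thesis
    using card_Un_Int [of "{e \<in> A. head e = v}" "{e \<in> A. tail e = v}"] finite_subset_E [OF assms]
    by (simp add: degree_in_def)
qed

lemma eulerian_iff_boundary: "A \<subseteq> E \<Longrightarrow> eulerian G A \<longleftrightarrow> boundary A = {}"
  by (auto simp: eulerian_def degree_in_eq boundary_def)

lemma boundary_sym_diff:
  assumes "A \<subseteq> E" "B \<subseteq> E"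
  shows "boundary (sym_diff A B) = sym_diff (boundary A) (boundary B)"
proof -
  have "odd (card {e \<in> sym_diff A B. f e = v}) \<longleftrightarrow>
      odd (card {e \<in> A. f e = v}) \<noteq> odd (card {e \<in> B. f e = v})" for f :: "'e \<Rightarrow> 'v" and v
    using assms finite_subset_E by (intro odd_card_filter_sym_diff)
  then show ?thesis
    unfolding boundary_def even_add by auto
qed

lemma boundary_empty [simp]: "boundary {} = {}"
  by (simp add: boundary_def)

lemma boundary_edge: "e \<in> E \<Longrightarrow> boundary {e} = sym_diff {tail e} {head e}"
proof -
  assume e: "e \<in> E"
  have "card {e' \<in> {e}. f e' = v} = of_bool (f e = v)" for f :: "'e \<Rightarrow> 'v" and v
  proof -
    have "{e' \<in> {e}. f e' = v} = (if f e = v then {e} else {})"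
      by auto
    then show ?thesis by simp
  qed
  then show ?thesis
    using e by (auto simp: boundary_def)
qed

text \<open>The edges of a walk are added modulo 2: inner vertices cancel, and so does an edge that
  is traversed twice.\<close>

lemma path_boundary:
  assumes "(u, v) \<in> (adjacency G)\<^sup>*"
  shows "\<exists>P\<subseteq>E. boundary P = sym_diff {u} {v}"
  using assms
proof induction
  case base
  then show ?case
    by (intro exI [of _ "{}"]) simp
next
  case (step v w)
  then obtain P where P: "P \<subseteq> E" "boundary P = sym_diff {u} {v}"
    by auto
  obtain e where e: "e \<in> E" "ends G e = Upair v w"
    using step by (auto simp: adjacency_def)
  then have "boundary {e} = sym_diff {v} {w}"
    using ends_eq boundary_edge by auto
  then have "boundary (sym_diff P {e}) = sym_diff (sym_diff {u} {v}) (sym_diff {v} {w})"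
    using boundary_sym_diff P e by simp
  also have "\<dots> = sym_diff {u} {w}"
    by blast
  finally show ?case
    using P e by (intro exI [of _ "sym_diff P {e}"]) auto
qed

section \<open>Connected components and T-joins\<close>

definition connected where
  "connected = {(u, v). u \<in> V \<and> v \<in> V \<and> (u, v) \<in> (adjacency G)\<^sup>*}"

lemma components_eq: "components G = V // connected"
  by (simp add: components_def connected_def)

lemma equiv_connected: "equiv V connected"
proof (rule equivI)
  have "sym (adjacency G)"
    by (auto intro!: symI simp: adjacency_def) (metis Upair_inject)
  then have "sym ((adjacency G)\<^sup>*)"
    by (rule sym_rtrancl)
  then show "sym connected"
    by (auto simp: sym_def connected_def)
  show "trans connected"
    unfolding connected_def by (rule transI) (auto intro: rtrancl_trans)
qed (auto simp: refl_on_def connected_def)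

lemma finite_components [simp]: "finite (components G)"
  unfolding components_eq by (rule finite_quotient) (auto simp: connected_def)

lemma component_subset: "K \<in> components G \<Longrightarrow> K \<subseteq> V"
  unfolding components_eq using equiv_connected by (rule in_quotient_imp_subset)

lemma component_nonempty: "K \<in> components G \<Longrightarrow> K \<noteq> {}"
  unfolding components_eq using equiv_connected by (rule in_quotient_imp_non_empty)

lemma component_disjoint:
  "K \<in> components G \<Longrightarrow> L \<in> components G \<Longrightarrow> K = L \<or> K \<inter> L = {}"
  unfolding components_eq using equiv_connected by (rule quotient_disj)

lemma head_in_component_iff:
  assumes "e \<in> E" "K \<in> components G"
  shows "head e \<in> K \<longleftrightarrow> tail e \<in> K"
proof -
  have "(tail e, head e) \<in> connected" "(head e, tail e) \<in> connected"
    using assms(1) ends_eq by (force simp: connected_def adjacency_def)+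
  then show ?thesis
    using assms(2) equiv_connected unfolding components_eq
    by (meson in_quotient_imp_closed)
qed

lemma sum_card_fiber:
  assumes "A \<subseteq> E" "K \<subseteq> V"
  shows "(\<Sum>v\<in>K. card {e \<in> A. f e = v}) = card {e \<in> A. f e \<in> K}"
proof -
  have "card (\<Union>v\<in>K. {e \<in> A. f e = v}) = (\<Sum>v\<in>K. card {e \<in> A. f e = v})"
    using assms finite_subset_E finite_subset [OF assms(2)] by (intro card_UN_disjoint) auto
  moreover have "(\<Union>v\<in>K. {e \<in> A. f e = v}) = {e \<in> A. f e \<in> K}"
    by auto
  ultimately show ?thesis by simp
qed

text \<open>No edge leaves a component. Equality, and not only equal parity, is what makes the
  excess in \<open>exists_conserving\<close> sum to 0 over a component.\<close>

lemma sum_out_eq_sum_in_component: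
  assumes "A \<subseteq> E" "K \<in> components G"
  shows "(\<Sum>v\<in>K. card {e \<in> A. head e = v}) = (\<Sum>v\<in>K. card {e \<in> A. tail e = v})"
proof -
  have "{e \<in> A. head e \<in> K} = {e \<in> A. tail e \<in> K}"
    using assms head_in_component_iff by blast
  then show ?thesis
    using assms component_subset by (simp add: sum_card_fiber)
qed

text \<open>The handshake argument within one component.\<close>

lemma even_boundary_Int_component:
  assumes "A \<subseteq> E" "K \<in> components G"
  shows "even (card (boundary A \<inter> K))"
proof -
  let ?d = "\<lambda>v. card {e \<in> A. head e = v} + card {e \<in> A. tail e = v}"
  have "even (\<Sum>v\<in>K. ?d v)"
    using sum_out_eq_sum_in_component [OF assms] by (simp add: sum.distrib)
  then have "even (card {v \<in> K. odd (?d v)})"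
    using even_sum_iff [of K ?d] finite_subset [OF component_subset [OF assms(2)]] by simp
  moreover have "boundary A \<inter> K = {v \<in> K. odd (?d v)}"
    using component_subset [OF assms(2)] by (auto simp: boundary_def)
  ultimately show ?thesis by simp
qed

text \<open>The set \<open>Y\<close> is a \<open>T\<close>-join: pair up the elements of \<open>T\<close> in each component by paths.\<close>

lemma exists_boundary_eq:
  assumes "T \<subseteq> V" "\<And>K. K \<in> components G \<Longrightarrow> even (card (T \<inter> K))"
  shows "\<exists>Y\<subseteq>E. boundary Y = T"
  using finite_subset [OF assms(1) finite_V] assms
proof (induction T rule: finite_psubset_induct)
  case (psubset T)
  show ?case
  proof (cases "T = {}")
    case True
    then show ?thesis
      by (intro exI [of _ "{}"]) simp
  next
    case False
    then obtain u where u: "u \<in> T" by auto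
    define K where "K = connected `` {u}"
    have uV: "u \<in> V" using u psubset.prems(1) by auto
    have K: "K \<in> components G" "u \<in> K"
      using uV equiv_class_self [OF equiv_connected uV]
      by (auto simp: components_eq K_def quotientI)
    have "even (card (T \<inter> K))" "u \<in> T \<inter> K" "finite (T \<inter> K)"
      using psubset.prems(2) [OF K(1)] K(2) u psubset.hyps by simp_all
    then have "T \<inter> K \<noteq> {u}"
      by (metis card_1_singleton_iff One_nat_def odd_one)
    then obtain v where v: "v \<in> T" "v \<in> K" "v \<noteq> u"
      using \<open>u \<in> T \<inter> K\<close> by blast
    have uv: "(u, v) \<in> (adjacency G)\<^sup>*"
      using v by (simp add: K_def connected_def)
    obtain P where P: "P \<subseteq> E" "boundary P = sym_diff {u} {v}"
      using path_boundary [OF uv] by (elim exE conjE)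
    then have "boundary P = {u, v}"
      using v by auto
    \<comment> \<open>Removing \<open>u\<close> and \<open>v\<close> lowers the count in
      \<open>K\<close> by 2 and leaves the other components alone; adding the path \<open>P\<close>
      modulo 2 then restores both vertices.\<close>
    have "\<exists>Y\<subseteq>E. boundary Y = T - {u, v}"
    proof (rule psubset.IH)
      fix L assume L: "L \<in> components G"
      show "even (card ((T - {u, v}) \<inter> L))"
      proof (cases "L = K")
        case True
        have "(T - {u, v}) \<inter> K = T \<inter> K - {u, v}" by auto
        moreover have "card (T \<inter> K - {u, v}) = card (T \<inter> K) - 2"
          using u v K by (subst card_Diff_subset) auto
        ultimately show ?thesis
          using True \<open>even (card (T \<inter> K))\<close> by simp
      next
        case False
        then have "(T - {u, v}) \<inter> L = T \<inter> L"
          using component_disjoint [OF K(1) L] K v by auto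
        then show ?thesis
          using psubset.prems(2) [OF L] by simp
      qed
    next
      show "T - {u, v} \<subset> T"
        using u by blast
      show "T - {u, v} \<subseteq> V"
        using psubset.prems(1) by blast
    qed
    then obtain Y where Y: "Y \<subseteq> E" "boundary Y = T - {u, v}"
      by auto
    have "boundary (sym_diff Y P) = sym_diff (T - {u, v}) {u, v}"
      using boundary_sym_diff [OF Y(1) P(1)] \<open>boundary P = {u, v}\<close> Y(2) by simp
    also have "\<dots> = T"
      using u v by blast
    finally have "boundary (sym_diff Y P) = T" .
    then show ?thesis
      using P Y by (intro exI [of _ "sym_diff Y P"]) auto
  qed
qed

section \<open>The number of eulerian sets\<close>

definition eulerian_sets :: "'e set set" where
  "eulerian_sets = {A \<in> Pow E. boundary A = {}}"

lemma finite_eulerian_sets [simp]: "finite eulerian_sets"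
  by (simp add: eulerian_sets_def)

text \<open>The right-hand side is written as the kernel of the parity map on \<open>Pow V\<close>,
  so that the kernel-image count applies to it in turn. One inclusion is the handshake argument, the
  other the existence of T-joins.\<close>

lemma boundary_image:
  "boundary ` Pow E = {T \<in> Pow V. {K \<in> components G. odd (card (T \<inter> K))} = {}}"
proof (intro equalityI subsetI)
  fix T assume "T \<in> boundary ` Pow E"
  then show "T \<in> {T \<in> Pow V. {K \<in> components G. odd (card (T \<inter> K))} = {}}"
    using even_boundary_Int_component by (auto simp: boundary_def)
next
  fix T assume "T \<in> {T \<in> Pow V. {K \<in> components G. odd (card (T \<inter> K))} = {}}"
  then show "T \<in> boundary ` Pow E"
    using exists_boundary_eq [of T] by auto
qed

text \<open>One representative from each chosen component forms a preimage.\<close>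

lemma odd_components_image:
  "(\<lambda>T. {K \<in> components G. odd (card (T \<inter> K))}) ` Pow V = Pow (components G)"
    (is "?h ` _ = _")
proof (intro equalityI subsetI)
  fix \<K> assume \<K>: "\<K> \<in> Pow (components G)"
  define rep where "rep K = (SOME v. v \<in> K)" for K :: "'v set"
  have rep: "rep K \<in> K" if "K \<in> components G" for K
    using component_nonempty [OF that] by (auto simp: rep_def some_in_eq)
  have rep_iff: "rep L \<in> K \<longleftrightarrow> L = K" if "K \<in> components G" "L \<in> components G" for K L
    using component_disjoint [OF that] rep [OF that(1)] rep [OF that(2)] by auto
  have "rep ` \<K> \<inter> K = (if K \<in> \<K> then {rep K} else {})" if "K \<in> components G" for K
  proof -
    have "rep L \<in> K \<longleftrightarrow> L = K" if "L \<in> \<K>" for L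
      using \<K> that \<open>K \<in> components G\<close> by (intro rep_iff) auto
    then show ?thesis by auto
  qed
  then have "odd (card (rep ` \<K> \<inter> K)) \<longleftrightarrow> K \<in> \<K>" if "K \<in> components G" for K
    using that by simp
  then have "?h (rep ` \<K>) = \<K>"
    using \<K> by blast
  moreover have "rep ` \<K> \<in> Pow V"
    using rep component_subset \<K> by blast
  ultimately show "\<K> \<in> ?h ` Pow V"
    by (rule image_eqI [OF sym])
qed auto

text \<open>Makes the natural-number subtraction in \<open>graph_rank\<close> exact.\<close>

lemma card_components_le: "card (components G) \<le> card V"
proof (rule surj_card_le)
  show "components G \<subseteq> (\<lambda>v. connected `` {v}) ` V"
    by (auto simp: components_eq quotient_def)
qed simp

text \<open>The kernel-image count is used for \<open>boundary\<close> and for the parity map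
  \<open>?h\<close>, which is onto the sets of components; hence the image of
  \<open>boundary\<close> has \<open>2 ^ graph_rank G\<close> elements.\<close>

lemma card_eulerian_sets: "card eulerian_sets * 2 ^ graph_rank G = 2 ^ card E"
proof -
  let ?h = "\<lambda>T. {K \<in> components G. odd (card (T \<inter> K))}"
  have "card eulerian_sets * card (boundary ` Pow E) = 2 ^ card E"
    unfolding eulerian_sets_def
    by (intro card_kernel_times_card_image_sym_diff boundary_sym_diff) auto
  moreover have "card (boundary ` Pow E) * card (?h ` Pow V) = 2 ^ card V"
    unfolding boundary_image
  proof (rule card_kernel_times_card_image_sym_diff)
    fix A B assume AB: "A \<subseteq> V" "B \<subseteq> V"
    have "odd (card (sym_diff A B \<inter> K)) \<longleftrightarrow> odd (card (A \<inter> K)) \<noteq> odd (card (B \<inter> K))" for K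
      using odd_card_filter_sym_diff [of A B "\<lambda>x. x \<in> K"] AB finite_subset [OF _ finite_V]
      by (simp add: Int_def)
    then show "?h (sym_diff A B) = sym_diff (?h A) (?h B)"
      by auto
  qed simp
  moreover have "card (?h ` Pow V) = 2 ^ card (components G)"
    by (simp add: odd_components_image card_Pow)
  moreover have "(2::nat) ^ card V = 2 ^ graph_rank G * 2 ^ card (components G)"
    using card_components_le by (simp add: graph_rank_def flip: power_add)
  ultimately show ?thesis
    by simp
qed

end

section \<open>Nowhere-zero flows modulo 4\<close>

text \<open>Splits a congruence modulo 4 into two conditions modulo 2. Later \<open>a\<close>,
  \<open>b\<close> count in- and out-edges with odd flow value, and \<open>c\<close>,
  \<open>d\<close> those with value at least 2.\<close>

lemma cong_4_iff:
  fixes a b c d :: nat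
  shows "[a + 2 * c = b + 2 * d] (mod 4) \<longleftrightarrow>
    even (int a - int b) \<and> (odd (c + d) \<longleftrightarrow> odd ((int a - int b) div 2))"
proof -
  have cong_iff: "[a + 2 * c = b + 2 * d] (mod 4) \<longleftrightarrow> 4 dvd (int a - int b) + 2 * (int c - int d)"
    by (simp add: cong_iff_dvd_diff algebra_simps flip: cong_int_iff)
  show ?thesis
  proof (cases "even (int a - int b)")
    case True
    then obtain k where k: "int a - int b = 2 * k"
      by (rule evenE)
    have "4 dvd 2 * k + 2 * (int c - int d) \<longleftrightarrow> 2 * 2 dvd 2 * (k + (int c - int d))"
      by (simp add: algebra_simps)
    also have "\<dots> \<longleftrightarrow> even (k + (int c - int d))"
      by (subst dvd_mult_cancel_left) simp
    finally show ?thesis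
      unfolding cong_iff k by auto
  next
    case False
    then have "odd ((int a - int b) + 2 * (int c - int d))"
      by simp
    then have "\<not> 4 dvd (int a - int b) + 2 * (int c - int d)"
      by (metis dvd_trans even_numeral)
    with False show ?thesis
      unfolding cong_iff by simp
  qed
qed

context oriented_multigraph
begin

text \<open>Conservation modulo 4 for the edge function with binary digits \<open>X\<close> (low)
  and \<open>Z\<close> (high).\<close>

definition conserving :: "'e set \<Rightarrow> 'e set \<Rightarrow> bool" where
  "conserving X Z \<longleftrightarrow>
     (\<forall>v\<in>V. [card {e \<in> X. head e = v} + 2 * card {e \<in> Z. head e = v} =
             card {e \<in> X. tail e = v} + 2 * card {e \<in> Z. tail e = v}] (mod 4))"

lemma conserving_imp_boundary_empty: "conserving X Z \<Longrightarrow> boundary X = {}"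
  by (auto simp: conserving_def boundary_def cong_4_iff)

text \<open>By \<open>cong_4_iff\<close>, \<open>Z\<close> enters only through the parity of its
  degrees. So for fixed \<open>X\<close> the admissible subsets of \<open>E\<close> form a coset of
  the eulerian sets.\<close>

lemma conserving_iff_boundary_eq:
  assumes "conserving X Y"
  shows "conserving X Z \<longleftrightarrow> boundary Z = boundary Y"
  using assms unfolding conserving_def boundary_def set_eq_iff mem_Collect_eq cong_4_iff by blast

text \<open>
  Halving the divergence of the indicator function of \<open>X\<close> leaves an integral function that sums
  to 0 over each component of \<open>(V, X)\<close>, so its odd part is the boundary of a set of edges of
  \<open>X\<close>.
\<close>

lemma exists_conserving:
  assumes "X \<subseteq> E" "boundary X = {}"
  shows "\<exists>Y\<subseteq>X. conserving X Y"
proof -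
  \<comment> \<open>The join must lie inside \<open>X\<close>, so the results on components and
    joins are applied to the subgraph with edge set \<open>X\<close>.\<close>
  interpret X: oriented_multigraph "G\<lparr>edges := X\<rparr>" tail head
  proof
    show "finite_multigraph (G\<lparr>edges := X\<rparr>)"
      using finite_multigraph assms(1) finite_subset_E by (auto simp: finite_multigraph_def)
    show "orientation (G\<lparr>edges := X\<rparr>) tail head"
      using orientation assms(1) by (auto simp: orientation_def)
  qed
  have X_boundary: "X.boundary A = boundary A" for A
    by (simp add: X.boundary_def boundary_def)
  define excess where "excess v = int (card {e \<in> X. head e = v}) - int (card {e \<in> X. tail e = v})" for v
  have even_excess: "even (excess v)" if "v \<in> V" for v
    using assms(2) that by (auto simp: boundary_def excess_def)
  \<comment> \<open>By \<open>cong_4_iff\<close>, \<open>T\<close> is exactly the boundary that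
    \<open>Y\<close> must have.\<close>
  define T where "T = {v \<in> V. odd (excess v div 2)}"
  have "even (card (T \<inter> K))" if K: "K \<in> components (G\<lparr>edges := X\<rparr>)" for K
  proof -
    have KV: "K \<subseteq> V"
      using X.component_subset [OF K] by simp
    have "2 * (\<Sum>v\<in>K. excess v div 2) = (\<Sum>v\<in>K. excess v)"
      unfolding sum_distrib_left using even_excess KV by (intro sum.cong) auto
    also have "\<dots> = 0"
      using arg_cong [OF X.sum_out_eq_sum_in_component [OF _ K, of X], of int]
      by (simp add: excess_def sum_subtractf)
    finally have "even (card {v \<in> K. odd (excess v div 2)})"
      using even_sum_iff [of K "\<lambda>v. excess v div 2"] finite_subset [OF KV finite_V] by simp
    moreover have "T \<inter> K = {v \<in> K. odd (excess v div 2)}"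
      using KV by (auto simp: T_def)
    ultimately show ?thesis by simp
  qed
  then obtain Y where Y: "Y \<subseteq> X" "boundary Y = T"
    using X.exists_boundary_eq [of T] X_boundary by (auto simp: T_def)
  have "conserving X Y"
    unfolding conserving_def
  proof
    fix v assume v: "v \<in> V"
    have "v \<in> boundary Y \<longleftrightarrow> v \<in> T"
      using Y by simp
    then show "[card {e \<in> X. head e = v} + 2 * card {e \<in> Y. head e = v} =
             card {e \<in> X. tail e = v} + 2 * card {e \<in> Y. tail e = v}] (mod 4)"
      using v even_excess [OF v] unfolding cong_4_iff by (simp add: boundary_def T_def excess_def)
  qed
  with Y show ?thesis by blast
qed

text \<open>The restriction to \<open>E\<close> makes the function extensional, as flows
  are.\<close>

definition encode :: "'e set \<Rightarrow> 'e set \<Rightarrow> 'e \<Rightarrow> nat" where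
  "encode X Z = restrict (\<lambda>e. of_bool (e \<in> X) + 2 * of_bool (e \<in> Z)) E"

lemma sum_encode:
  assumes "X \<subseteq> E" "Z \<subseteq> E"
  shows "(\<Sum>e | e \<in> E \<and> f e = v. encode X Z e) =
    card {e \<in> X. f e = v} + 2 * card {e \<in> Z. f e = v}"
proof -
  have "(\<Sum>e | e \<in> E \<and> f e = v. of_bool (e \<in> A)) = card {e \<in> A. f e = v}" if "A \<subseteq> E" for A
  proof -
    have "{e. e \<in> E \<and> f e = v} \<inter> {e. e \<in> A} = {e \<in> A. f e = v}"
      using that by auto
    then show ?thesis
      by simp
  qed
  then show ?thesis
    using assms by (simp add: encode_def sum.distrib flip: sum_distrib_left)
qed

lemma encode_in_nowhere_zero_flows_iff:
  assumes "X \<subseteq> E" "Z \<subseteq> E"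
  shows "encode X Z \<in> nowhere_zero_flows G tail head 4 \<longleftrightarrow> X \<union> Z = E \<and> conserving X Z"
proof -
  have "encode X Z \<in> E \<rightarrow>\<^sub>E {0..<4}"
    by (auto simp: encode_def)
  moreover have "(\<forall>e\<in>E. encode X Z e \<noteq> 0) \<longleftrightarrow> X \<union> Z = E"
    using assms by (auto simp: encode_def)
  ultimately show ?thesis
    using assms by (simp add: nowhere_zero_flows_def sum_encode conserving_def)
qed

lemma encode_inject:
  assumes "encode X Z = encode X' Z'" "X \<subseteq> E" "Z \<subseteq> E" "X' \<subseteq> E" "Z' \<subseteq> E"
  shows "X = X' \<and> Z = Z'"
proof -
  have "(e \<in> X \<longleftrightarrow> e \<in> X') \<and> (e \<in> Z \<longleftrightarrow> e \<in> Z')" if "e \<in> E" for e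
    using fun_cong [OF assms(1), of e] that by (auto simp: encode_def of_bool_def split: if_splits)
  then show ?thesis
    using assms(2-) by blast
qed

lemma encode_surj:
  assumes "f \<in> E \<rightarrow>\<^sub>E {0..<4}"
  shows "f = encode {e \<in> E. odd (f e)} {e \<in> E. 2 \<le> f e}"
proof
  fix e
  have "n = of_bool (odd n) + 2 * of_bool (2 \<le> n)" if "n < 4" for n :: nat
  proof -
    have "n = 0 \<or> n = 1 \<or> n = 2 \<or> n = 3"
      using that by presburger
    then show ?thesis by auto
  qed
  then show "f e = encode {e \<in> E. odd (f e)} {e \<in> E. 2 \<le> f e} e"
    using assms by (auto simp: encode_def PiE_iff extensional_def)
qed

definition covers :: "('e set \<times> 'e set) set" where
  "covers = {(X, Y) \<in> eulerian_sets \<times> eulerian_sets. X \<union> Y = E}"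

lemma flow_number_4: "flow_number G tail head 4 = card covers"
proof -
  define pairs where "pairs = {(X, Z) \<in> Pow E \<times> Pow E. X \<union> Z = E \<and> conserving X Z}"
  have "bij_betw (\<lambda>(X, Z). encode X Z) pairs (nowhere_zero_flows G tail head 4)"
  proof (rule bij_betw_imageI)
    show "inj_on (\<lambda>(X, Z). encode X Z) pairs"
      using encode_inject by (auto simp: inj_on_def pairs_def)
    have "f \<in> (\<lambda>(X, Z). encode X Z) ` pairs" if f: "f \<in> nowhere_zero_flows G tail head 4" for f
    proof -
      define X Z where "X = {e \<in> E. odd (f e)}" and "Z = {e \<in> E. 2 \<le> f e}"
      have "f = encode X Z"
        unfolding X_def Z_def using f by (intro encode_surj) (simp add: nowhere_zero_flows_def)
      moreover have "X \<subseteq> E" "Z \<subseteq> E"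
        by (auto simp: X_def Z_def)
      ultimately show ?thesis
        using f encode_in_nowhere_zero_flows_iff by (force simp: pairs_def)
    qed
    then show "(\<lambda>(X, Z). encode X Z) ` pairs = nowhere_zero_flows G tail head 4"
      using encode_in_nowhere_zero_flows_iff by (auto simp: pairs_def)
  qed
  then have flow_number: "flow_number G tail head 4 = card pairs"
    unfolding flow_number_def by (rule bij_betw_same_card [symmetric])
  have "\<forall>X\<in>eulerian_sets. \<exists>Y. Y \<subseteq> X \<and> conserving X Y"
    using exists_conserving by (auto simp: eulerian_sets_def)
  from bchoice [OF this] obtain Y
    where Y: "\<And>X. X \<in> eulerian_sets \<Longrightarrow> Y X \<subseteq> X \<and> conserving X (Y X)"
    by blast
  \<comment> \<open>Since \<open>Y X\<close> lies inside \<open>X\<close>, translating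
    \<open>Z\<close> by it does not change the union with \<open>X\<close>, while it turns
    conservation into the condition of being eulerian.\<close>
  have shift: "(X, sym_diff Z (Y X)) \<in> covers \<longleftrightarrow> (X, Z) \<in> pairs"
    if "X \<in> eulerian_sets" "Z \<subseteq> E" for X Z
  proof -
    have YX: "Y X \<subseteq> X" "conserving X (Y X)" "X \<subseteq> E"
      using Y that by (auto simp: eulerian_sets_def)
    have "boundary (sym_diff Z (Y X)) = {} \<longleftrightarrow> boundary Z = boundary (Y X)"
      using boundary_sym_diff [of Z "Y X"] YX that by auto
    moreover have "X \<union> sym_diff Z (Y X) = X \<union> Z"
      using YX by auto
    ultimately show ?thesis
      using YX that conserving_iff_boundary_eq [OF YX(2), of Z]
      by (auto simp: covers_def pairs_def eulerian_sets_def)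
  qed
  have pairs_eulerian: "X \<in> eulerian_sets \<and> Z \<subseteq> E" if "(X, Z) \<in> pairs" for X Z
    using that conserving_imp_boundary_empty by (auto simp: pairs_def eulerian_sets_def)
  have covers_eulerian: "X \<in> eulerian_sets \<and> W \<subseteq> E" if "(X, W) \<in> covers" for X W
    using that by (auto simp: covers_def eulerian_sets_def)
  have Y_subset: "Y X \<subseteq> E" if "X \<in> eulerian_sets" for X
    using Y [OF that] that by (auto simp: eulerian_sets_def)
  have "bij_betw (\<lambda>(X, Z). (X, sym_diff Z (Y X))) pairs covers"
  proof (rule bij_betw_byWitness [where f' = "\<lambda>(X, W). (X, sym_diff W (Y X))"])
    show "(\<lambda>(X, Z). (X, sym_diff Z (Y X))) ` pairs \<subseteq> covers"
      using shift pairs_eulerian by (auto simp del: Un_iff Diff_iff)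
    show "(\<lambda>(X, W). (X, sym_diff W (Y X))) ` covers \<subseteq> pairs"
    proof clarify
      fix X W assume XW: "(X, W) \<in> covers"
      then have "(X, sym_diff (sym_diff W (Y X)) (Y X)) \<in> covers"
        by (simp only: sym_diff_cancel)
      then show "(X, sym_diff W (Y X)) \<in> pairs"
        using covers_eulerian [OF XW] Y_subset [of X] by (subst (asm) shift) auto
    qed
  qed (clarsimp simp only: sym_diff_cancel split_beta fst_conv snd_conv prod.collapse)+
  then have "card pairs = card covers"
    by (rule bij_betw_same_card)
  with flow_number show ?thesis by simp
qed

end

section \<open>Sums over triples of edge sets\<close>

lemma bias_pmf_of_set:
  assumes "finite \<Omega>" "\<Omega> \<noteq> {}"
  shows "bias (measure_pmf (pmf_of_set \<Omega>)) P = (\<Sum>t\<in>\<Omega>. if P t then 1 else -1) / card \<Omega>"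
proof -
  have "(\<Sum>t\<in>\<Omega>. if P t then 1 else -1 :: real) = real (card (\<Omega> \<inter> {t. P t})) - real (card (\<Omega> \<inter> {t. \<not> P t}))"
    using assms(1) by (simp add: sum.If_cases Compl_eq)
  then show ?thesis
    using assms by (simp add: bias_def measure_pmf_of_set diff_divide_distrib)
qed

text \<open>The factors \<open>card \<Omega>\<close> cancel. If no element satisfies
  \<open>Q\<close>, both sides are 0, as division by 0 yields 0.\<close>

lemma cond_bias_pmf_of_set:
  assumes "finite \<Omega>" "\<Omega> \<noteq> {}"
  shows "cond_bias (measure_pmf (pmf_of_set \<Omega>)) P Q =
    (\<Sum>t\<in>{t \<in> \<Omega>. Q t}. if P t then 1 else -1) / card {t \<in> \<Omega>. Q t}"
proof -
  have "(\<Sum>t\<in>{t \<in> \<Omega>. Q t}. if P t then 1 else -1 :: real) =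
      real (card (\<Omega> \<inter> {t. P t \<and> Q t})) - real (card (\<Omega> \<inter> {t. \<not> P t \<and> Q t}))"
  proof -
    have "{t \<in> \<Omega>. Q t} \<inter> {t. R t} = \<Omega> \<inter> {t. R t \<and> Q t}" for R
      by auto
    then show ?thesis
      using assms(1) by (simp add: sum.If_cases Compl_eq)
  qed
  moreover have "\<Omega> \<inter> {t. Q t} = {t \<in> \<Omega>. Q t}"
    by auto
  ultimately show ?thesis
    using assms by (simp add: cond_bias_def cond_prob_def measure_pmf_of_set diff_divide_distrib)
qed

lemma random_edge_sets_eq:
  assumes "finite (edges G)"
  shows "random_edge_sets G =
    pmf_of_set (Pow (edges G) \<times> Pow (edges G) \<times> Pow (edges G))"
proof (rule pmf_eqI)
  fix t :: "'a set \<times> 'a set \<times> 'a set"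
  obtain A B C where t: "t = (A, B, C)"
    by (cases t)
  have "Pow (edges G) \<noteq> {}" "finite (Pow (edges G))"
    using assms by auto
  then show "pmf (random_edge_sets G) t =
      pmf (pmf_of_set (Pow (edges G) \<times> Pow (edges G) \<times> Pow (edges G))) t"
    unfolding t random_edge_sets_def
    by (auto simp: pmf_pair indicator_def card_cartesian_product)
qed

definition total_size :: "'e set \<times> 'e set \<times> 'e set \<Rightarrow> nat" where
  "total_size = (\<lambda>(A, B, C). card A + card B + card C)"

section \<open>The sign as a combination of powers\<close>

definition \<omega> :: complex where "\<omega> = Complex (1/2) (sqrt 3 / 2)"
text \<open>Twice the Fourier coefficient \<open>(1 + 1/\<omega> + 1/\<omega>^2) / 3\<close> of the
  sign; the doubling lets a real part account for the conjugate root.\<close>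

definition \<gamma> :: complex where "\<gamma> = Complex (2/3) (- 2 * sqrt 3 / 3)"

lemma omega_squared: "\<omega> ^ 2 = \<omega> - 1"
  by (simp add: \<omega>_def power2_eq_square complex_eq_iff)

lemma omega_cubed: "\<omega> ^ 3 = -1"
proof -
  have "\<omega> ^ 3 = \<omega> * \<omega> ^ 2"
    by (simp add: power3_eq_cube power2_eq_square)
  also have "\<dots> = \<omega> * (\<omega> - 1)"
    by (simp only: omega_squared)
  also have "\<dots> = \<omega> ^ 2 - \<omega>"
    by (simp add: algebra_simps power2_eq_square)
  finally show ?thesis
    by (simp add: omega_squared)
qed

definition sign6 :: "nat \<Rightarrow> real" where
  "sign6 n = (if n mod 6 \<in> {0, 1, 2} then 1 else -1)"

text \<open>
  The sign changes when \<open>n\<close> grows by 3, hence it is a combination of the \<open>n\<close>-th powers of the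
  three cube roots of \<open>-1\<close>; the coefficients of \<open>\<omega>\<close> and its conjugate are \<open>\<gamma> / 2\<close> and its
  conjugate.
\<close>

lemma sign6_eq: "sign6 n = Re ((-1) ^ n / 3 + \<gamma> * \<omega> ^ n)"
proof -
  have period: "(-1::complex) ^ n = (-1) ^ (n mod 6)" "\<omega> ^ n = \<omega> ^ (n mod 6)"
  proof -
    have "\<omega> ^ 6 = (\<omega> ^ 3) ^ 2"
      by (simp flip: power_mult)
    then have "\<omega> ^ 6 = 1"
      by (simp add: omega_cubed)
    moreover have "x ^ n = (x ^ 6) ^ (n div 6) * x ^ (n mod 6)" for x :: complex
      by (simp flip: power_mult power_add)
    ultimately show "(-1::complex) ^ n = (-1) ^ (n mod 6)" "\<omega> ^ n = \<omega> ^ (n mod 6)"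
      by simp_all
  qed
  have powers: "\<omega> ^ 4 = - \<omega>" "\<omega> ^ 5 = 1 - \<omega>"
  proof -
    have "\<omega> ^ 4 = \<omega> ^ 3 * \<omega>" "\<omega> ^ 5 = \<omega> ^ 3 * \<omega> ^ 2"
      by (simp_all flip: power_Suc2 power_add)
    then show "\<omega> ^ 4 = - \<omega>" "\<omega> ^ 5 = 1 - \<omega>"
      by (simp_all add: omega_cubed omega_squared)
  qed
  have "n mod 6 = 0 \<or> n mod 6 = 1 \<or> n mod 6 = 2 \<or> n mod 6 = 3 \<or> n mod 6 = 4 \<or> n mod 6 = 5"
    by presburger
  then show ?thesis
    unfolding sign6_def period
    by (elim disjE) (simp_all add: omega_squared omega_cubed powers, simp_all add: \<omega>_def \<gamma>_def)
qed

lemma sum_sign6: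
  "(\<Sum>t\<in>S. sign6 (f t)) = Re ((\<Sum>t\<in>S. (-1) ^ f t) / 3 + \<gamma> * (\<Sum>t\<in>S. \<omega> ^ f t))"
  by (simp add: sign6_eq sum.distrib sum_divide_distrib sum_distrib_left)

lemma size_012_mod_6_iff: "(if size_012_mod_6 t then 1 else -1) = sign6 (total_size t)"
  by (auto simp: size_012_mod_6_def sign6_def total_size_def split: prod.splits)

lemma sum_total_size:
  fixes z :: complex
  assumes "finite E" "z ^ 3 = -1"
  shows "(\<Sum>t\<in>Pow E \<times> Pow E \<times> Pow E. z ^ total_size t) = (3 * (z + z ^ 2)) ^ card E"
proof -
  have "(\<Sum>t\<in>Pow E \<times> Pow E \<times> Pow E. z ^ total_size t) =
      (\<Sum>A\<in>Pow E. z ^ card A) * ((\<Sum>A\<in>Pow E. z ^ card A) * (\<Sum>A\<in>Pow E. z ^ card A))"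
    by (simp add: total_size_def power_add split_beta sum_product sum.cartesian_product mult.assoc)
  also have "\<dots> = ((1 + z) ^ 3) ^ card E"
    using assms(1) by (simp add: sum_Pow_power_card power3_eq_cube power_mult_distrib mult.assoc)
  also have "(1 + z) ^ 3 = 1 + z ^ 3 + 3 * (z + z ^ 2)"
    by (simp add: power3_eq_cube power2_eq_square algebra_simps)
  finally show ?thesis
    by (simp add: assms(2))
qed

text \<open>Here \<open>\<omega> + \<omega> ^ 2\<close> is \<open>sqrt 3\<close> times the imaginary
  unit, so its powers are real or purely imaginary and nonzero; since \<open>\<gamma>\<close> has
  nonzero real and imaginary parts, the product has nonzero real part.\<close>

lemma sum_sign6_total_size_nonzero:
  assumes "finite E"
  shows "(\<Sum>t\<in>Pow E \<times> Pow E \<times> Pow E. sign6 (total_size t)) \<noteq> 0"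
proof (cases "E = {}")
  case True
  then show ?thesis
    by (simp add: total_size_def sign6_def)
next
  case False
  let ?u = "\<omega> + \<omega> ^ 2"
  define m where "m = card E"
  have "m \<noteq> 0"
    using False assms by (simp add: m_def)
  have u: "?u = Complex 0 (sqrt 3)"
    by (simp add: omega_squared, simp add: \<omega>_def complex_eq_iff)
  have u2: "?u ^ 2 = -3"
    unfolding u by (simp add: power2_eq_square complex_eq_iff)
  \<comment> \<open>For \<open>z = -1\<close> the base \<open>z + z ^ 2\<close> is 0, so this term
    vanishes as \<open>m\<close> is positive; the empty edge set was treated apart because
    \<open>0 ^ 0 = 1\<close>.\<close>
  have sum_eq: "(\<Sum>t\<in>Pow E \<times> Pow E \<times> Pow E. sign6 (total_size t)) = Re (\<gamma> * (3 * ?u) ^ m)"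
    unfolding sum_sign6
    using sum_total_size [OF assms, of "-1"] sum_total_size [OF assms omega_cubed] \<open>m \<noteq> 0\<close>
    by (simp add: m_def)
  have scale: "Re (\<gamma> * (3 * u) ^ m) = 3 ^ m * Re (\<gamma> * u ^ m)" for u
  proof -
    have "\<gamma> * (3 * u) ^ m = of_real (3 ^ m) * (\<gamma> * u ^ m)"
      by (simp add: power_mult_distrib)
    then show ?thesis
      by (simp only: Re_complex_of_real Im_complex_of_real times_complex.simps mult_zero_left diff_zero)
  qed
  have nonzero: "Re (\<gamma> * ?u ^ m) \<noteq> 0"
  proof (cases "even m")
    case True
    then obtain j where j: "m = 2 * j" ..
    have "?u ^ m = of_real ((-3) ^ j)"
      unfolding j power_mult u2 by simp
    then show ?thesis
      by (simp add: \<gamma>_def)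
  next
    case False
    then obtain j where j: "m = 2 * j + 1"
      by (rule oddE)
    have "?u ^ m = of_real ((-3) ^ j) * ?u"
      unfolding j power_add power_mult u2 by simp
    then show ?thesis
      unfolding u by (simp add: \<gamma>_def)
  qed
  show ?thesis
    unfolding sum_eq scale mult_eq_0_iff using nonzero by (metis power_not_zero zero_neq_numeral)
qed

section \<open>The sum over the event \<Delta>\<close>

context oriented_multigraph
begin

lemma in_eulerian_sets_iff: "A \<in> eulerian_sets \<longleftrightarrow> A \<subseteq> E \<and> eulerian G A"
  using eulerian_iff_boundary by (auto simp: eulerian_sets_def)

lemma sym_diff_in_eulerian_sets:
  "X \<in> eulerian_sets \<Longrightarrow> Y \<in> eulerian_sets \<Longrightarrow> sym_diff X Y \<in> eulerian_sets"
  using boundary_sym_diff [of X Y] by (auto simp: eulerian_sets_def)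

abbreviation pairwise_eulerian_triples where
  "pairwise_eulerian_triples \<equiv> {t \<in> Pow E \<times> Pow E \<times> Pow E. pairwise_eulerian G t}"

text \<open>The differences \<open>X\<close> and \<open>Y\<close> of \<open>A\<close> and
  \<open>B\<close> with \<open>C\<close> can be chosen freely: the third difference is
  \<open>sym_diff X Y\<close>, which is again eulerian.\<close>

lemma sum_pairwise_eulerian_triples:
  "(\<Sum>t\<in>pairwise_eulerian_triples. g t) =
   (\<Sum>(X, Y)\<in>eulerian_sets \<times> eulerian_sets. \<Sum>C\<in>Pow E. g (sym_diff C X, sym_diff C Y, C))"
proof -
  have "(\<Sum>t\<in>pairwise_eulerian_triples. g t) =
      (\<Sum>((X, Y), C)\<in>(eulerian_sets \<times> eulerian_sets) \<times> Pow E. g (sym_diff C X, sym_diff C Y, C))"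
  proof (rule sum.reindex_bij_witness
      [where i = "\<lambda>((X, Y), C). (sym_diff C X, sym_diff C Y, C)"
         and j = "\<lambda>(A, B, C). ((sym_diff C A, sym_diff C B), C)"])
    fix t assume t: "t \<in> pairwise_eulerian_triples"
    obtain A B C where ABC: "t = (A, B, C)"
      by (cases t)
    have "sym_diff C B = sym_diff B C"
      by (rule Un_commute)
    then show "(case t of (A, B, C) \<Rightarrow> ((sym_diff C A, sym_diff C B), C))
        \<in> (eulerian_sets \<times> eulerian_sets) \<times> Pow E"
      using t by (auto simp: ABC pairwise_eulerian_def in_eulerian_sets_iff)
  next
    fix t assume t: "t \<in> (eulerian_sets \<times> eulerian_sets) \<times> Pow E"
    obtain X Y C where XYC: "t = ((X, Y), C)"
      by (metis surj_pair)
    have XY: "X \<in> eulerian_sets" "Y \<in> eulerian_sets" "C \<subseteq> E"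
      using t by (auto simp: XYC)
    have "sym_diff (sym_diff C X) (sym_diff C Y) = sym_diff X Y"
      "sym_diff (sym_diff C Y) C = Y" "sym_diff C (sym_diff C X) = X"
      by blast+
    then have "pairwise_eulerian G (sym_diff C X, sym_diff C Y, C)"
      using XY sym_diff_in_eulerian_sets [OF XY(1,2)]
      by (simp only: pairwise_eulerian_def in_eulerian_sets_iff split_conv)
    then show "(\<lambda>((X, Y), C). (sym_diff C X, sym_diff C Y, C)) t
        \<in> pairwise_eulerian_triples"
      using XY by (auto simp: XYC in_eulerian_sets_iff)
  qed (simp_all only: split_beta fst_conv snd_conv sym_diff_cancel prod.collapse)
  then show ?thesis
    by (simp only: case_prod_unfold sum.cartesian_product)
qed

lemma card_pairwise_eulerian_triples:
  "card pairwise_eulerian_triples = card eulerian_sets ^ 2 * 2 ^ card E"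
  using sum_pairwise_eulerian_triples [of "\<lambda>_. 1 :: nat"]
  by (simp add: card_Pow card_cartesian_product power2_eq_square split_beta)

text \<open>
  The sum factorises over the edges, and an edge outside \<open>X \<union> Y\<close> contributes
  \<open>1 + z\<^sup>3 = 0\<close>.
\<close>

lemma sum_sym_diff_total_size:
  fixes z :: complex
  assumes "X \<subseteq> E" "Y \<subseteq> E" "z ^ 3 = -1"
  shows "(\<Sum>C\<in>Pow E. z ^ total_size (sym_diff C X, sym_diff C Y, C)) =
    (if X \<union> Y = E then (z + z ^ 2) ^ card E else 0)"
proof -
  \<comment> \<open>\<open>a e\<close> and \<open>b e\<close> tell how many of the three sets
    contain \<open>e\<close> when \<open>e\<close> is in \<open>C\<close> and when it is not; the
    last summands 1 and 0 stand for \<open>C\<close> itself.\<close>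
  define a where "a e = of_bool (e \<notin> X) + of_bool (e \<notin> Y) + (1::nat)" for e
  define b where "b e = of_bool (e \<in> X) + of_bool (e \<in> Y) + (0::nat)" for e
  have exponent: "total_size (sym_diff C X, sym_diff C Y, C) = sum a C + sum b (E - C)"
    if C: "C \<in> Pow E" for C
  proof -
    have fin: "finite C"
      using C finite_subset_E by auto
    have card_eq: "card (sym_diff C Z) = (\<Sum>e\<in>C. of_bool (e \<notin> Z)) + (\<Sum>e\<in>E - C. of_bool (e \<in> Z))"
      if "Z \<subseteq> E" for Z
    proof -
      have "C \<inter> {e. e \<notin> Z} = C - Z" "(E - C) \<inter> {e. e \<in> Z} = Z - C"
        using that by auto
      moreover have "card (sym_diff C Z) = card (C - Z) + card (Z - C)"
        using fin finite_subset_E [OF that] by (intro card_Un_disjoint) auto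
      ultimately show ?thesis
        using fin by simp
    qed
    show ?thesis
      unfolding total_size_def a_def b_def sum.distrib
      using card_eq [OF assms(1)] card_eq [OF assms(2)] by simp
  qed
  have "(\<Sum>C\<in>Pow E. z ^ total_size (sym_diff C X, sym_diff C Y, C)) = (\<Prod>e\<in>E. z ^ a e + z ^ b e)"
    by (simp add: exponent prod_add power_add power_sum)
  \<comment> \<open>The exponents \<open>a e\<close>, \<open>b e\<close> are 1, 2 if
    \<open>e\<close> is in both \<open>X\<close> and \<open>Y\<close>, 2, 1 if it is in exactly one,
    and 3, 0 if in neither.\<close>
  also have "\<dots> = (\<Prod>e\<in>E. if e \<in> X \<union> Y then z + z ^ 2 else 0)"
  proof (rule prod.cong)
    fix e
    have "z ^ 3 + 1 = 0"
      using assms(3) by simp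
    then show "z ^ a e + z ^ b e = (if e \<in> X \<union> Y then z + z ^ 2 else 0)"
      by (simp add: a_def b_def numeral_eq_Suc)
  qed simp
  also have "\<dots> = (if X \<union> Y = E then (z + z ^ 2) ^ card E else 0)"
  proof (cases "X \<union> Y = E")
    case True
    then show ?thesis
      unfolding True by simp
  next
    case False
    then obtain e where "e \<in> E" "e \<notin> X \<union> Y"
      using assms(1,2) by blast
    with False show ?thesis
      by (auto intro!: prod_zero)
  qed
  finally show ?thesis .
qed

lemma sum_total_size_pairwise_eulerian:
  fixes z :: complex
  assumes "z ^ 3 = -1"
  shows "(\<Sum>t\<in>pairwise_eulerian_triples. z ^ total_size t) = card covers * (z + z ^ 2) ^ card E"
proof -
  have "(\<Sum>t\<in>pairwise_eulerian_triples. z ^ total_size t) =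
      (\<Sum>(X, Y)\<in>eulerian_sets \<times> eulerian_sets. if X \<union> Y = E then (z + z ^ 2) ^ card E else 0)"
    unfolding sum_pairwise_eulerian_triples
    using assms sum_sym_diff_total_size by (intro sum.cong) (auto simp: eulerian_sets_def)
  also have "\<dots> = (\<Sum>p\<in>covers. (z + z ^ 2) ^ card E)"
  proof (rule sum.mono_neutral_cong_right)
    show "covers \<subseteq> eulerian_sets \<times> eulerian_sets"
      by (auto simp: covers_def)
    show "\<forall>p\<in>eulerian_sets \<times> eulerian_sets - covers.
        (case p of (X, Y) \<Rightarrow> if X \<union> Y = E then (z + z ^ 2) ^ card E else 0) = 0"
    proof
      fix p assume "p \<in> eulerian_sets \<times> eulerian_sets - covers"
      then show "(case p of (X, Y) \<Rightarrow> if X \<union> Y = E then (z + z ^ 2) ^ card E else 0) = 0"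
        by (cases p) (simp add: covers_def)
    qed
  qed (simp_all add: covers_def split_beta)
  finally show ?thesis
    by simp
qed

text \<open>Both power sums contain \<open>(z + z ^ 2) ^ card E\<close>; the remaining factors are
  the same real numbers for every cube root of -1, so the relation passes to the combination and its
  real part.\<close>

lemma sum_sign6_pairwise_eulerian:
  "3 ^ card E * (\<Sum>t\<in>pairwise_eulerian_triples. sign6 (total_size t)) =
   card covers * (\<Sum>t\<in>Pow E \<times> Pow E \<times> Pow E. sign6 (total_size t))"
proof -
  let ?D = "\<lambda>z::complex. \<Sum>t\<in>pairwise_eulerian_triples. z ^ total_size t"
  let ?S = "\<lambda>z::complex. \<Sum>t\<in>Pow E \<times> Pow E \<times> Pow E. z ^ total_size t"
  have eq: "of_real (3 ^ card E) * ?D z = of_real (card covers) * ?S z" if "z ^ 3 = -1" for z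
    using that by (simp add: sum_total_size sum_total_size_pairwise_eulerian power_mult_distrib
        del: distrib_left_numeral)
  have "3 ^ card E * (\<Sum>t\<in>pairwise_eulerian_triples. sign6 (total_size t)) =
      Re ((of_real (3 ^ card E) * ?D (-1)) / 3 + \<gamma> * (of_real (3 ^ card E) * ?D \<omega>))"
    unfolding sum_sign6 by (simp add: algebra_simps)
  also have "\<dots> = Re ((of_real (card covers) * ?S (-1)) / 3 + \<gamma> * (of_real (card covers) * ?S \<omega>))"
    by (subst (1 2) eq) (simp_all add: omega_cubed)
  also have "\<dots> = card covers * (\<Sum>t\<in>Pow E \<times> Pow E \<times> Pow E. sign6 (total_size t))"
    unfolding sum_sign6 by (simp add: algebra_simps)
  finally show ?thesis .
qed

end

theorem theorem2p20:
  fixes G :: "('v, 'e) multigraph"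
    and tail head :: "'e \<Rightarrow> 'v"
  assumes "finite_multigraph G"
    and "orientation G tail head"
  shows "bias (random_edge_sets G) size_012_mod_6 \<noteq> 0 \<and>
    cond_bias (random_edge_sets G) size_012_mod_6 (pairwise_eulerian G) /
      bias (random_edge_sets G) size_012_mod_6 =
    3 powi (- int (card (edges G))) * 4 ^ graph_rank G * real (flow_number G tail head 4)"
proof -
  interpret oriented_multigraph G tail head
    using assms by unfold_locales
  define m where "m = card E"
  define \<Omega> where "\<Omega> = Pow E \<times> Pow E \<times> Pow E"
  define \<epsilon> where "\<epsilon> = real (card eulerian_sets)"
  define S where "S = (\<Sum>t\<in>\<Omega>. sign6 (total_size t))"
  define D where "D = (\<Sum>t\<in>pairwise_eulerian_triples. sign6 (total_size t))"
  have \<Omega>: "finite \<Omega>" "\<Omega> \<noteq> {}" "card \<Omega> = 8 ^ m"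
    by (auto simp: \<Omega>_def m_def card_cartesian_product card_Pow simp flip: power_mult_distrib)
  have "S \<noteq> 0"
    unfolding S_def \<Omega>_def by (rule sum_sign6_total_size_nonzero) simp
  have D: "3 ^ m * D = card covers * S"
    unfolding D_def S_def \<Omega>_def m_def by (rule sum_sign6_pairwise_eulerian)
  have eps: "\<epsilon> * 2 ^ graph_rank G = 2 ^ m"
    using arg_cong [OF card_eulerian_sets, of real] by (simp add: \<epsilon>_def m_def)
  then have "\<epsilon> \<noteq> 0"
    by auto
  have bias: "bias (random_edge_sets G) size_012_mod_6 = S / 8 ^ m"
    using \<Omega> by (simp add: random_edge_sets_eq bias_pmf_of_set size_012_mod_6_iff S_def flip: \<Omega>_def)
  have cond_bias: "cond_bias (random_edge_sets G) size_012_mod_6 (pairwise_eulerian G) =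
      D / (\<epsilon> ^ 2 * 2 ^ m)"
    using \<Omega>(1,2) card_pairwise_eulerian_triples
    by (simp add: random_edge_sets_eq cond_bias_pmf_of_set size_012_mod_6_iff D_def \<epsilon>_def m_def \<Omega>_def)
  \<comment> \<open>The factor \<open>4 ^ graph_rank G\<close> is the ratio of the two
    normalisations: all triples against those in \<Delta>, with \<open>2 ^ m\<close> rewritten by
    \<open>eps\<close>.\<close>
  have "(8::real) ^ m = 2 ^ m * (2 ^ m) ^ 2"
    by (simp add: power2_eq_square flip: power_mult_distrib)
  also have "\<dots> = 2 ^ m * \<epsilon> ^ 2 * 4 ^ graph_rank G"
    unfolding eps [symmetric] by (simp add: power_mult_distrib power2_eq_square flip: power_mult_distrib)
  finally have "D / (\<epsilon> ^ 2 * 2 ^ m) / (S / 8 ^ m) = D * 4 ^ graph_rank G / S"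
    using \<open>\<epsilon> \<noteq> 0\<close> \<open>S \<noteq> 0\<close> by (simp add: field_simps)
  also have "\<dots> = inverse (3 ^ m) * 4 ^ graph_rank G * real (card covers)"
    using D \<open>S \<noteq> 0\<close> by (simp add: field_simps)
  finally have "cond_bias (random_edge_sets G) size_012_mod_6 (pairwise_eulerian G) /
      bias (random_edge_sets G) size_012_mod_6 = inverse (3 ^ m) * 4 ^ graph_rank G * real (card covers)"
    unfolding bias cond_bias .
  then show ?thesis
    using \<open>S \<noteq> 0\<close> by (simp add: bias flow_number_4 power_int_minus m_def)
qed

end
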